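(* If $n$ is a non-negative integer and $p$ is a non-zero integer, then $$\sum_{k=1}^n(-1)^{n-k}\frac{k}{n+k}\binom{n+k}{n-k}\left(\frac{2L_{2p}}{\sqrt5F_{2p}}\right)^{2k}=(-1)^p\,\frac{L_{2p}\left(L_p^{4n}-5^{2n}F_p^{4n}\right)}{4(\sqrt5F_{2p})^{2n}}.$$
   Context: $F_n$ and $L_n$ ($n\in\mathbb{Z}$) are the Fibonacci and Lucas numbers: $F_0=0$, $F_1=1$, $F_n=F_{n-1}+F_{n-2}$; $L_0=2$, $L_1=1$, $L_n=L_{n-1}+L_{n-2}$, extended to negative indices by $F_{-n}=(-1)^{n-1}F_n$, $L_{-n}=(-1)^nL_n$. An empty sum is $0$. *)

theory Defs
  imports Complex_Main "HOL-Number_Theory.Fib"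
begin

fun lucas :: "nat \<Rightarrow> nat" where
  "lucas 0 = 2"
| "lucas (Suc 0) = 1"
| "lucas (Suc (Suc n)) = lucas (Suc n) + lucas n"

text \<open>Extensions to negative indices by \<open>F\<^sub>-\<^sub>n = (-1)\<^sup>n\<^sup>-\<^sup>1 F\<^sub>n\<close> and \<open>L\<^sub>-\<^sub>n = (-1)\<^sup>n L\<^sub>n\<close>.
  In the first one the truncated subtraction is harmless, since there \<open>nat (- m) \<ge> 1\<close>.\<close>

definition fib_int :: "int \<Rightarrow> int" where
  "fib_int m = (if 0 \<le> m then int (fib (nat m))
                else (- 1) ^ (nat (- m) - 1) * int (fib (nat (- m))))"

definition lucas_int :: "int \<Rightarrow> int" where
  "lucas_int m = (if 0 \<le> m then int (lucas (nat m))
                  else (- 1) ^ nat (- m) * int (lucas (nat (- m))))"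

end

theory Submission
  imports Defs
begin

text \<open>Since \<open>k/(n+k) \<cdot> C(n+k, n-k) = C(n+k-1, n-k)/2\<close>, the left-hand side is \<open>x/2\<close> times
  \<open>U\<^bsub>2n-1\<^esub>(x/2)\<close>, a Chebyshev polynomial of the second kind. At \<open>x = y + 1/y\<close> this is
  \<open>(x/2) (y\<^bsup>2n\<^esup> - y\<^bsup>-2n\<^esup>) / (y - 1/y)\<close>. By Binet's formulas, \<open>x = 2L\<^bsub>2p\<^esub>/(\<surd>5 F\<^bsub>2p\<^esub>)\<close> corresponds to
  \<open>y = L\<^sub>p/(\<surd>5 F\<^sub>p)\<close>.\<close>

definition power_diff_quot :: "nat \<Rightarrow> 'a::comm_ring_1 \<Rightarrow> 'a \<Rightarrow> 'a" where
  "power_diff_quot m s q = (\<Sum>j\<le>m. (-1) ^ j * of_nat ((m - j) choose j) * s ^ (m - 2 * j) * q ^ j)"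

text \<open>Truncation in the exponent \<open>m - 2 * j\<close> is harmless: the binomial coefficient vanishes there.\<close>

lemma power_diff_quot_Suc_Suc:
  "power_diff_quot (Suc (Suc m)) s q = s * power_diff_quot (Suc m) s q - q * power_diff_quot m s q"
proof -
  let ?t = "\<lambda>m j. (-1) ^ j * of_nat ((m - j) choose j) * s ^ (m - 2 * j) * q ^ j"
  \<comment> \<open>Pascal's rule, term by term: the two binomials it yields belong to index
    \<open>Suc j\<close> of the sum for \<open>Suc m\<close> and index \<open>j\<close> of the sum
    for \<open>m\<close>.\<close>
  have step: "?t (Suc (Suc m)) (Suc j) = s * ?t (Suc m) (Suc j) - q * ?t m j" if "j \<le> m" for j
  proof -
    have pascal: "(Suc (Suc m) - Suc j) choose Suc j = ((m - j) choose j) + ((m - j) choose Suc j)"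
      using that by (simp add: Suc_diff_le)
    have exponent: "Suc (Suc m) - 2 * Suc j = m - 2 * j" by simp
    \<comment> \<open>The exponents agree only if \<open>Suc m - 2 * Suc j\<close> does not
      truncate; otherwise the binomial coefficient makes both sides 0.\<close>
    have shift: "s * (of_nat ((m - j) choose Suc j) * s ^ (Suc m - 2 * Suc j))
        = of_nat ((m - j) choose Suc j) * s ^ (m - 2 * j)"
    proof (cases "Suc j \<le> m - j")
      case True
      then have "m - 2 * j = Suc (Suc m - 2 * Suc j)" by arith
      then show ?thesis by (simp add: mult_ac)
    next
      case False
      then show ?thesis by (simp add: binomial_eq_0)
    qed
    have "s * ?t (Suc m) (Suc j)
        = (-1) ^ Suc j * (s * (of_nat ((m - j) choose Suc j) * s ^ (Suc m - 2 * Suc j))) * q ^ Suc j"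
      by (simp add: mult_ac)
    then show ?thesis
      unfolding pascal shift exponent power_Suc of_nat_add by (simp only: algebra_simps) simp
  qed
  have "power_diff_quot (Suc (Suc m)) s q = (\<Sum>j\<le>Suc m. ?t (Suc (Suc m)) j)"
    by (simp add: power_diff_quot_def)
  also have "\<dots> = ?t (Suc (Suc m)) 0 + (\<Sum>j\<le>m. ?t (Suc (Suc m)) (Suc j))"
    by (rule sum.atMost_Suc_shift)
  also have "(\<Sum>j\<le>m. ?t (Suc (Suc m)) (Suc j)) = (\<Sum>j\<le>m. s * ?t (Suc m) (Suc j) - q * ?t m j)"
    by (intro sum.cong refl step) simp
  also have "\<dots> = s * (\<Sum>j\<le>m. ?t (Suc m) (Suc j)) - q * (\<Sum>j\<le>m. ?t m j)"
    by (simp only: sum_subtractf sum_distrib_left)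
  also have "?t (Suc (Suc m)) 0 + (s * (\<Sum>j\<le>m. ?t (Suc m) (Suc j)) - q * (\<Sum>j\<le>m. ?t m j))
      = s * (?t (Suc m) 0 + (\<Sum>j\<le>m. ?t (Suc m) (Suc j))) - q * (\<Sum>j\<le>m. ?t m j)"
    by (simp add: algebra_simps)
  also have "?t (Suc m) 0 + (\<Sum>j\<le>m. ?t (Suc m) (Suc j)) = (\<Sum>j\<le>Suc m. ?t (Suc m) j)"
    by (rule sum.atMost_Suc_shift [symmetric])
  finally show ?thesis by (simp only: power_diff_quot_def)
qed

text \<open>Both sides satisfy the recurrence with characteristic roots \<open>a\<close> and
  \<open>b\<close>; \<open>fib.induct\<close> supplies the two base cases. So the sum is the Lucas
  sequence U_{m+1}(s, q) for s = a + b, q = ab. Avoiding division keeps it valid in every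
  commutative ring.\<close>

lemma power_diff_quot_add_mult:
  "(a - b) * power_diff_quot m (a + b) (a * b) = a ^ Suc m - b ^ Suc m"
proof (induction m rule: fib.induct)
  case (3 m)
  have "(a - b) * power_diff_quot (Suc (Suc m)) (a + b) (a * b)
      = (a + b) * ((a - b) * power_diff_quot (Suc m) (a + b) (a * b))
        - a * b * ((a - b) * power_diff_quot m (a + b) (a * b))"
    by (simp add: power_diff_quot_Suc_Suc algebra_simps)
  also have "\<dots> = a ^ Suc (Suc (Suc m)) - b ^ Suc (Suc (Suc m))"
    unfolding 3 by (simp add: algebra_simps)
  finally show ?case .
qed (simp_all add: power_diff_quot_def algebra_simps)

text \<open>Absorption, where the factor (n+k) - (n-k) is 2k.\<close>

lemma weighted_binomial_eq:
  assumes "1 \<le> k" "k \<le> n"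
  shows "real k / real (n + k) * real ((n + k) choose (n - k)) = real ((n + k - 1) choose (n - k)) / 2"
proof -
  have "(n + k) * ((n + k - 1) choose (n - k)) = 2 * k * ((n + k) choose (n - k))"
    using binomial_absorb_comp[of "n + k" "n - k"] assms by (simp add: mult_2)
  then have "real (n + k) * real ((n + k - 1) choose (n - k)) = 2 * real k * real ((n + k) choose (n - k))"
    by (metis of_nat_mult of_nat_numeral)
  then show ?thesis using assms by (simp add: field_simps)
qed

text \<open>Substitute j = n - k; one factor x comes out because 2k = 1 + (2n - 1 - 2j). The case n
  = 0 is separate: there \<open>2 * n - 1\<close> truncates to 0 and the formula would give
  x/2.\<close>

lemma sum_weighted_binomial_eq:
  fixes x :: real
  shows "(\<Sum>k=1..n. (-1) ^ (n - k) * (real k / real (n + k)) * real ((n + k) choose (n - k)) * x ^ (2 * k))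
    = (if n = 0 then 0 else x / 2 * power_diff_quot (2 * n - 1) x 1)"
proof (cases "n = 0")
  case False
  let ?t = "\<lambda>j. (-1) ^ j * real ((2 * n - 1 - j) choose j) * x ^ (2 * n - 1 - 2 * j)"
  have "(\<Sum>k=1..n. (-1) ^ (n - k) * (real k / real (n + k)) * real ((n + k) choose (n - k)) * x ^ (2 * k))
      = (\<Sum>k=1..n. x / 2 * ?t (n - k))"
  proof (rule sum.cong)
    fix k assume "k \<in> {1..n}"
    then have k: "1 \<le> k" "k \<le> n" by auto
    have "2 * k = Suc (2 * n - 1 - 2 * (n - k))"
      using k by arith
    then have pow: "x ^ (2 * k) = x * x ^ (2 * n - 1 - 2 * (n - k))"
      by (metis power_Suc)
    have top: "n + k - 1 = 2 * n - 1 - (n - k)"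
      using k by arith
    have "(-1) ^ (n - k) * (real k / real (n + k)) * real ((n + k) choose (n - k)) * x ^ (2 * k)
        = (-1) ^ (n - k) * (real ((2 * n - 1 - (n - k)) choose (n - k)) / 2) * x ^ (2 * k)"
      using weighted_binomial_eq[OF k] unfolding top by (simp only: mult.assoc)
    then show "(-1) ^ (n - k) * (real k / real (n + k)) * real ((n + k) choose (n - k)) * x ^ (2 * k)
        = x / 2 * ?t (n - k)"
      unfolding pow by simp
  qed simp
  also have "\<dots> = (\<Sum>j<n. x / 2 * ?t j)"
    by (rule sum.reindex_bij_witness[of _ "\<lambda>j. n - j" "\<lambda>k. n - k"]) auto
  \<comment> \<open>For j \<ge> n the upper index 2n - 1 - j is below j, so the added terms
    vanish.\<close>
  also have "\<dots> = (\<Sum>j\<le>2 * n - 1. x / 2 * ?t j)"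
    using False by (intro sum.mono_neutral_left) (auto simp: binomial_eq_0)
  finally show ?thesis
    using False by (simp add: power_diff_quot_def sum_distrib_left)
qed simp

text \<open>The roots \<open>y\<close> and \<open>1 / y\<close> have product 1, hence the last
  argument 1 of \<open>power_diff_quot\<close>.\<close>

lemma sum_weighted_binomial_mult:
  fixes y :: real
  assumes "y \<noteq> 0"
  shows "(y - 1 / y) * (\<Sum>k=1..n. (-1) ^ (n - k) * (real k / real (n + k)) *
           real ((n + k) choose (n - k)) * (y + 1 / y) ^ (2 * k))
    = (y + 1 / y) / 2 * (y ^ (2 * n) - (1 / y) ^ (2 * n))"
proof (cases "n = 0")
  case False
  then have "Suc (2 * n - 1) = 2 * n" by simp
  with power_diff_quot_add_mult[of y "1 / y" "2 * n - 1"] assms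
  have "(y - 1 / y) * power_diff_quot (2 * n - 1) (y + 1 / y) 1 = y ^ (2 * n) - (1 / y) ^ (2 * n)"
    by simp
  then show ?thesis
    unfolding sum_weighted_binomial_eq using False by (simp add: mult_ac)
qed simp

definition golden :: real where "golden = (1 + sqrt 5) / 2"

definition golden_conj :: real where "golden_conj = (1 - sqrt 5) / 2"

lemma golden_mult_conj: "golden * golden_conj = -1"
  by (simp add: golden_def golden_conj_def algebra_simps)

lemma golden_square: "golden * golden = golden + 1" "golden_conj * golden_conj = golden_conj + 1"
  by (simp_all add: golden_def golden_conj_def field_simps)

lemma golden_power_Suc_Suc:
  "golden ^ Suc (Suc n) = golden ^ Suc n + golden ^ n"
  "golden_conj ^ Suc (Suc n) = golden_conj ^ Suc n + golden_conj ^ n"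
  using golden_square by (simp_all add: algebra_simps flip: mult.assoc)

lemma fib_binet: "sqrt 5 * real (fib n) = golden ^ n - golden_conj ^ n"
  by (simp add: fib_closed_form golden_def golden_conj_def)

lemma lucas_binet: "real (lucas n) = golden ^ n + golden_conj ^ n"
proof (induction n rule: lucas.induct)
  case (3 n)
  then show ?case
    unfolding golden_power_Suc_Suc by (simp add: algebra_simps)
qed (simp_all add: golden_def golden_conj_def field_simps)

text \<open>As the roots have product -1, inverting one gives minus the other. This swap produces
  the signs in \<open>fib_int\<close> and \<open>lucas_int\<close>.\<close>

lemma golden_powi_minus:
  "golden powi (- int m) = (-1) ^ m * golden_conj ^ m"
  "golden_conj powi (- int m) = (-1) ^ m * golden ^ m"
proof -
  have "inverse golden = - golden_conj" "inverse golden_conj = - golden"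
    using golden_mult_conj by (auto intro!: inverse_unique simp: mult.commute)
  then show "golden powi (- int m) = (-1) ^ m * golden_conj ^ m"
    "golden_conj powi (- int m) = (-1) ^ m * golden ^ m"
    by (simp_all add: power_int_minus power_minus[of golden] power_minus[of golden_conj] flip: power_inverse)
qed

lemma fib_int_binet: "sqrt 5 * real_of_int (fib_int p) = golden powi p - golden_conj powi p"
proof (cases p rule: int_cases4)
  case (neg m)
  \<comment> \<open>Here m > 0, so \<open>m - 1\<close> does not truncate. The extra minus sign is
    absorbed by swapping the roots in their difference.\<close>
  then have "(-1) ^ (m - 1) = - ((-1) ^ m :: real)" by (cases m) auto
  then have "sqrt 5 * real_of_int (fib_int p) = - ((-1) ^ m) * (sqrt 5 * real (fib m))"
    using neg by (simp add: fib_int_def)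
  then show ?thesis
    unfolding fib_binet by (simp add: neg golden_powi_minus algebra_simps)
qed (simp add: fib_int_def fib_binet)

lemma lucas_int_binet: "real_of_int (lucas_int p) = golden powi p + golden_conj powi p"
proof (cases p rule: int_cases4)
  case (neg m)
  then have "real_of_int (lucas_int p) = (-1) ^ m * real (lucas m)"
    by (simp add: lucas_int_def)
  then show ?thesis
    unfolding lucas_binet by (simp add: neg golden_powi_minus algebra_simps)
qed (simp add: lucas_int_def lucas_binet)

lemma fib_int_nonzero: "p \<noteq> 0 \<Longrightarrow> fib_int p \<noteq> 0"
  by (auto simp: fib_int_def fib_neq_0_nat)

theorem theorem19:
  fixes n :: nat and p :: int
  assumes "p \<noteq> 0"
  shows "(\<Sum>k=1..n. (- 1) ^ (n - k) * (real k / real (n + k)) * real ((n + k) choose (n - k)) *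
            (2 * real_of_int (lucas_int (2 * p)) / (sqrt 5 * real_of_int (fib_int (2 * p)))) ^ (2 * k))
         = (- 1) powi p *
           (real_of_int (lucas_int (2 * p)) *
              (real_of_int (lucas_int p) ^ (4 * n) - 5 ^ (2 * n) * real_of_int (fib_int p) ^ (4 * n))
            / (4 * (sqrt 5 * real_of_int (fib_int (2 * p))) ^ (2 * n)))"
proof -
  define u where "u = golden powi p"
  define v where "v = golden_conj powi p"
  define y where "y = (u + v) / (u - v)"
  have F: "sqrt 5 * real_of_int (fib_int p) = u - v"
    and L: "real_of_int (lucas_int p) = u + v"
    by (simp_all add: u_def v_def fib_int_binet lucas_int_binet)
  have F2: "sqrt 5 * real_of_int (fib_int (2 * p)) = (u + v) * (u - v)"
    and L2: "real_of_int (lucas_int (2 * p)) = u\<^sup>2 + v\<^sup>2"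
    by (simp_all add: u_def v_def fib_int_binet lucas_int_binet power_int_mult power_int_power'
        mult.commute[of 2 p] power2_eq_square algebra_simps)
  have uv: "u * v = (-1) powi p"
    by (simp add: u_def v_def golden_mult_conj flip: power_int_mult_distrib)
  \<comment> \<open>The product is \<surd>5 times the Fibonacci number at 2p, so its being nonzero
    makes both factors nonzero.\<close>
  have "(u + v) * (u - v) \<noteq> 0"
    using fib_int_nonzero[of "2 * p"] assms by (simp flip: F2)
  then have nz: "u + v \<noteq> 0" "u - v \<noteq> 0" by auto
  then have y0: "y \<noteq> 0" by (simp add: y_def)
  have x: "2 * (u\<^sup>2 + v\<^sup>2) / ((u + v) * (u - v)) = y + 1 / y"
    using nz by (simp add: y_def divide_simps) (simp add: power2_eq_square algebra_simps)
  \<comment> \<open>The numerator is (u+v)^2 - (u-v)^2. Since uv = (-1)^p is its own inverse, it can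
    move across the equation; this is the source of the sign and of the 4 in the theorem.\<close>
  have "y - 1 / y = 4 * (u * v) / ((u + v) * (u - v))"
    using nz by (simp add: y_def divide_simps) (simp add: power2_eq_square algebra_simps)
  then have "(y - 1 / y) * (u * v * ((u + v) * (u - v))) = 4 * (u * v * (u * v))"
    using nz by simp
  moreover have "u * v * (u * v) = 1"
    unfolding uv by (simp flip: power_int_mult_distrib)
  ultimately have coeff: "(y - 1 / y) * (u * v * ((u + v) * (u - v))) = 4"
    by simp
  have "(sqrt 5 * real_of_int (fib_int p)) ^ (4 * n) = 5 ^ (2 * n) * real_of_int (fib_int p) ^ (4 * n)"
  proof -
    have "sqrt 5 ^ (4 * n) = ((sqrt 5)\<^sup>2) ^ (2 * n)"
      by (simp only: power_mult [symmetric]) simp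
    then show ?thesis by (simp add: power_mult_distrib)
  qed
  then have F4: "5 ^ (2 * n) * real_of_int (fib_int p) ^ (4 * n) = (u - v) ^ (4 * n)"
    by (simp add: F)
  have pow: "y ^ (2 * n) - (1 / y) ^ (2 * n)
      = ((u + v) ^ (4 * n) - (u - v) ^ (4 * n)) / ((u + v) * (u - v)) ^ (2 * n)"
  proof -
    have double: "c ^ (4 * n) = c ^ (2 * n) * c ^ (2 * n)" for c :: real
      by (simp flip: power_add)
    have "1 / y = (u - v) / (u + v)" by (simp add: y_def)
    then have "y ^ (2 * n) - (1 / y) ^ (2 * n)
        = (u + v) ^ (2 * n) / (u - v) ^ (2 * n) - (u - v) ^ (2 * n) / (u + v) ^ (2 * n)"
      by (simp only: y_def power_divide)
    also have "\<dots> = ((u + v) ^ (2 * n) * (u + v) ^ (2 * n) - (u - v) ^ (2 * n) * (u - v) ^ (2 * n))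
        / ((u + v) ^ (2 * n) * (u - v) ^ (2 * n))"
      using diff_frac_eq[of "(u - v) ^ (2 * n)" "(u + v) ^ (2 * n)"] nz by (simp add: mult.commute)
    finally show ?thesis by (simp only: double power_mult_distrib)
  qed
  define w where "w = u\<^sup>2 + v\<^sup>2"
  define S where "S = (\<Sum>k=1..n. (-1) ^ (n - k) * (real k / real (n + k)) *
      real ((n + k) choose (n - k)) * (y + 1 / y) ^ (2 * k))"
  \<comment> \<open>Writing 4 as the product in \<open>coeff\<close> exposes (y - 1/y) S without a
    division.\<close>
  have "4 * S = u * v * ((u + v) * (u - v)) * ((y - 1 / y) * S)"
    unfolding coeff [symmetric] by (simp only: mult_ac)
  also have "(y - 1 / y) * S = (y + 1 / y) / 2 * (y ^ (2 * n) - (1 / y) ^ (2 * n))"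
    unfolding S_def by (rule sum_weighted_binomial_mult [OF y0])
  also have "u * v * ((u + v) * (u - v)) * \<dots>
      = u * v * ((u + v) * (u - v) * (y + 1 / y)) / 2 * (y ^ (2 * n) - (1 / y) ^ (2 * n))"
    by simp
  \<comment> \<open>The remaining factor clears the denominator of x = y + 1/y, leaving twice the
    Lucas number at 2p.\<close>
  also have "(u + v) * (u - v) * (y + 1 / y) = 2 * w"
    unfolding x [symmetric] w_def using nz by simp
  finally have "4 * S = u * v * (w * ((u + v) ^ (4 * n) - (u - v) ^ (4 * n)))
      / ((u + v) * (u - v)) ^ (2 * n)"
    unfolding pow by (simp add: mult.assoc)
  from arg_cong [OF this, of "\<lambda>t. t / 4"]
  have "S = u * v * (w * ((u + v) ^ (4 * n) - (u - v) ^ (4 * n))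
      / (4 * ((u + v) * (u - v)) ^ (2 * n)))"
    by (simp add: mult.commute [of 4])
  then show ?thesis
    unfolding F2 L2 F4 L x uv S_def w_def .
qed

end
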